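(* Let $\Omega\subset\mathbb{R}^n$ be compact and convex, $f\in C^1(\Omega)$ with $L$-Lipschitz gradient on $\Omega$ ($L>0$), and let $\mathcal{A}$ be a method satisfying the angle condition $\mathrm{SB}_{\mathcal A}(\Omega)=\tau>0$ and such that the SSC procedure always terminates in a finite number of steps. Let $\mu>0$ and let $x^*\in\Omega$ be a stationary point for which there are $\eta,\delta>0$ such that $$\pi_x(-\nabla f(x))\ge\sqrt{2\mu}\,(f(x)-f(x^* ))^{1/2}$$ for every $x\in\Omega$ with $\|x-x^*\|<\delta$ and $f(x^* )<f(x)<f(x^* )+\eta$. Let $q=\left(1+\frac{\mu}{L}\frac{\tau^2}{(1+\tau)^2}\right)^{-1}$. Then there exists $\tilde\delta>0$ such that, for every sequence $\{x_k\}$ generated by the first-order method with SSC satisfying $$\|x_k-x^*\|<\delta\ \Longrightarrow\ f(x_{k+1})\ge f(x^* )\qquad\text{for all }k,$$ if $\|x_0-x^*\|<\tilde\delta$ then for all $k$ $$f(x_k)-f(x^* )\le q^k\,(f(x_0)-f(x^* )),$$ and $x_k\to\tilde x^*$ with $$\|x_k-\tilde x^*\|\le\frac{\sqrt{2-2q}\,\sqrt{f(x_0)-f(\tilde x^* )}}{\sqrt L\,(1-\sqrt q)}\,q^{k/2}\quad\text{for all }k,$$ for some stationary point $\tilde x^*$ with $f(\tilde x^* )=f(x^* )$.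
   Context: $\|\cdot\|$ is the Euclidean norm, $\hat c=c/\|c\|$ for $c\ne0$ and $\hat0=0$, $\bar B_R(x)$ the closed ball. $f\in C^1(\Omega)$ means continuously differentiable on an open set containing $\Omega$; $\|\nabla f(x)-\nabla f(y)\|\le L\|x-y\|$ for $x,y\in\Omega$. $T_\Omega(x)=\mathrm{cl}\{w:\exists\lambda>0,\ x+\lambda w\in\Omega\}$, $\pi(C,\cdot)$ is the Euclidean projection on a closed convex set $C$, $\pi_x(g)=\|\pi(T_\Omega(x),g)\|$; $x$ is stationary if $\pi_x(-\nabla f(x))=0$. A method $\mathcal{A}$ assigns to every $(x,g)\in\Omega\times\mathbb{R}^n$ a set $\mathcal{A}(x,g)\subset (T_\Omega(x)\cap\{d:\langle g,d\rangle>0\})\cup\{0\}$ of feasible directions at $x$, with $\mathcal{A}(x,g)=\{0\}$ if $\pi_x(g)=0$ and $0\notin\mathcal{A}(x,g)\ne\emptyset$ otherwise. $\mathrm{DSB}_{\mathcal A}(\Omega,x,g)=\inf_{d\in\mathcal{A}(x,g)}\frac{\langle g,d\rangle}{\pi_x(g)\|d\|}$ if $\pi_x(g)\neq0$, and $=1$ otherwise; $\mathrm{SB}_{\mathcal A}(\Omega)=\inf_{x\in\Omega,g\in\mathbb{R}^n}\mathrm{DSB}_{\mathcal A}(\Omega,x,g)$. First-order method with SSC: from $x_0\in\Omega$, while $x_k$ is not stationary set $x_{k+1}=\mathrm{SSC}(x_k,-\nabla f(x_k))$. If some $x_m$ is stationary, the convention is $x_k=x_m$ for all $k\ge m$. Procedure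 $\mathrm{SSC}(\bar x,g)$ (with $g=-\nabla f(\bar x)$): set $y_0=\bar x$, $j=0$. (1) Select $d_j\in\mathcal A(y_j,g)$ and a maximal stepsize $\alpha^{(j)}_{\max}>0$ with $y_j+\alpha d_j\in\Omega$ for $\alpha\in[0,\alpha_{\max}^{(j)}]$. If $d_j=0$, return $y_j$. (2) Let $\Omega_j=\bar B_{\|g\|/(2L)}\!\left(\bar x+\frac{g}{2L}\right)\cap\bar B_{\langle g,\hat d_j\rangle/L}(\bar x)$, and let $\beta_j=0$ if $y_j\notin\Omega_j$, $\beta_j=\max\{\beta\ge0:y_j+\beta d_j\in\Omega_j\}$ if $y_j\in\Omega_j$. Set $\alpha_j=\min(\alpha^{(j)}_{\max},\beta_j)$, $y_{j+1}=y_j+\alpha_jd_j$. If $\alpha_j=\beta_j$, return $y_{j+1}$; otherwise set $j=j+1$ and go to (1). *)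

theory Defs
  imports "HOL-Analysis.Analysis"
begin

definition grad :: "('a::euclidean_space \<Rightarrow> real) \<Rightarrow> 'a \<Rightarrow> 'a" where
  "grad f x = (THE D. GDERIV f x :> D)"

definition C1_near :: "'a::euclidean_space set \<Rightarrow> ('a \<Rightarrow> real) \<Rightarrow> bool" where
  "C1_near \<Omega> f \<longleftrightarrow>
     (\<exists>U. open U \<and> \<Omega> \<subseteq> U \<and> (\<forall>x\<in>U. f differentiable (at x)) \<and> continuous_on U (grad f))"

definition feasible_directions :: "'a::euclidean_space set \<Rightarrow> 'a \<Rightarrow> 'a set" where
  "feasible_directions \<Omega> x = {w. \<exists>t>0. x + t *\<^sub>R w \<in> \<Omega>}"

definition tangent_cone :: "'a::euclidean_space set \<Rightarrow> 'a \<Rightarrow> 'a set" where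
  "tangent_cone \<Omega> x = closure (feasible_directions \<Omega> x)"

definition proj_norm :: "'a::euclidean_space set \<Rightarrow> 'a \<Rightarrow> 'a \<Rightarrow> real" where
  "proj_norm \<Omega> x g = norm (closest_point (tangent_cone \<Omega> x) g)"

definition stationary :: "'a::euclidean_space set \<Rightarrow> ('a \<Rightarrow> real) \<Rightarrow> 'a \<Rightarrow> bool" where
  "stationary \<Omega> f x \<longleftrightarrow> proj_norm \<Omega> x (- grad f x) = 0"

text \<open>A method selects feasible directions in the strict sense, i.e. directions along which a
  positive step stays in the set. Membership in the tangent cone alone does not ensure this, since
  the cone is a closure.\<close>

definition is_method :: "'a::euclidean_space set \<Rightarrow> ('a \<Rightarrow> 'a \<Rightarrow> 'a set) \<Rightarrow> bool" where
  "is_method \<Omega> A \<longleftrightarrow>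
     (\<forall>x\<in>\<Omega>. \<forall>g.
        A x g \<subseteq> feasible_directions \<Omega> x \<and>
        A x g \<subseteq> (tangent_cone \<Omega> x \<inter> {d. g \<bullet> d > 0}) \<union> {0} \<and>
        (proj_norm \<Omega> x g = 0 \<longrightarrow> A x g = {0}) \<and>
        (proj_norm \<Omega> x g \<noteq> 0 \<longrightarrow> 0 \<notin> A x g \<and> A x g \<noteq> {}))"

text \<open>For a method and a nonempty set, both infima below range over nonempty sets of
  nonnegative reals.\<close>

definition DSB :: "('a::euclidean_space \<Rightarrow> 'a \<Rightarrow> 'a set) \<Rightarrow> 'a set \<Rightarrow> 'a \<Rightarrow> 'a \<Rightarrow> real" where
  "DSB A \<Omega> x g =
     (if proj_norm \<Omega> x g \<noteq> 0
      then INF d\<in>A x g. (g \<bullet> d) / (proj_norm \<Omega> x g * norm d)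
      else 1)"

definition SB :: "('a::euclidean_space \<Rightarrow> 'a \<Rightarrow> 'a set) \<Rightarrow> 'a set \<Rightarrow> real" where
  "SB A \<Omega> = (INF (x, g)\<in>\<Omega> \<times> UNIV. DSB A \<Omega> x g)"

text \<open>For compact \<open>\<Omega>\<close>, \<open>y \<in> \<Omega>\<close> and \<open>d \<noteq> 0\<close> the greatest step exists; it is positive
  when \<open>d\<close> is a feasible direction and \<open>\<Omega>\<close> is convex.\<close>

definition max_step :: "'a::euclidean_space set \<Rightarrow> 'a \<Rightarrow> 'a \<Rightarrow> real" where
  "max_step \<Omega> y d = (GREATEST a. 0 \<le> a \<and> (\<forall>t\<in>{0..a}. y + t *\<^sub>R d \<in> \<Omega>))"

definition ssc_region :: "real \<Rightarrow> 'a::euclidean_space \<Rightarrow> 'a \<Rightarrow> 'a \<Rightarrow> 'a set" where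
  "ssc_region L xbar g d =
     cball (xbar + (1 / (2 * L)) *\<^sub>R g) (norm g / (2 * L)) \<inter> cball xbar ((g \<bullet> sgn d) / L)"

definition ssc_beta :: "real \<Rightarrow> 'a::euclidean_space \<Rightarrow> 'a \<Rightarrow> 'a \<Rightarrow> 'a \<Rightarrow> real" where
  "ssc_beta L xbar g y d =
     (if y \<in> ssc_region L xbar g d
      then GREATEST b. 0 \<le> b \<and> y + b *\<^sub>R d \<in> ssc_region L xbar g d
      else 0)"

definition ssc_alpha ::
  "'a::euclidean_space set \<Rightarrow> real \<Rightarrow> 'a \<Rightarrow> 'a \<Rightarrow> 'a \<Rightarrow> 'a \<Rightarrow> real" where
  "ssc_alpha \<Omega> L xbar g y d = min (max_step \<Omega> y d) (ssc_beta L xbar g y d)"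

text \<open>The choice of a direction makes the procedure nondeterministic, so it is a transition
  relation on the iterates \<open>y\<^sub>j\<close>: \<open>ssc_continue\<close> is an iteration that goes back to the selection of
  a direction, \<open>ssc_return\<close> one that returns a point. The parameters \<open>xbar\<close> and \<open>g\<close> stay fixed
  during a run.\<close>

definition ssc_continue ::
  "('a::euclidean_space \<Rightarrow> 'a \<Rightarrow> 'a set) \<Rightarrow> 'a set \<Rightarrow> real \<Rightarrow> 'a \<Rightarrow> 'a \<Rightarrow> 'a \<Rightarrow> 'a \<Rightarrow> bool" where
  "ssc_continue A \<Omega> L xbar g y y' \<longleftrightarrow>
     (\<exists>d\<in>A y g. d \<noteq> 0 \<and> ssc_alpha \<Omega> L xbar g y d \<noteq> ssc_beta L xbar g y d \<and>
        y' = y + ssc_alpha \<Omega> L xbar g y d *\<^sub>R d)"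

definition ssc_return ::
  "('a::euclidean_space \<Rightarrow> 'a \<Rightarrow> 'a set) \<Rightarrow> 'a set \<Rightarrow> real \<Rightarrow> 'a \<Rightarrow> 'a \<Rightarrow> 'a \<Rightarrow> 'a \<Rightarrow> bool" where
  "ssc_return A \<Omega> L xbar g y z \<longleftrightarrow>
     (\<exists>d\<in>A y g. (d = 0 \<and> z = y) \<or>
        (d \<noteq> 0 \<and> ssc_alpha \<Omega> L xbar g y d = ssc_beta L xbar g y d \<and>
         z = y + ssc_alpha \<Omega> L xbar g y d *\<^sub>R d))"

definition SSC ::
  "('a::euclidean_space \<Rightarrow> 'a \<Rightarrow> 'a set) \<Rightarrow> 'a set \<Rightarrow> real \<Rightarrow> 'a \<Rightarrow> 'a \<Rightarrow> 'a set" where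
  "SSC A \<Omega> L xbar g =
     {z. \<exists>y. (ssc_continue A \<Omega> L xbar g)\<^sup>*\<^sup>* xbar y \<and> ssc_return A \<Omega> L xbar g y z}"

definition ssc_terminates ::
  "('a::euclidean_space \<Rightarrow> 'a \<Rightarrow> 'a set) \<Rightarrow> 'a set \<Rightarrow> real \<Rightarrow> 'a \<Rightarrow> 'a \<Rightarrow> bool" where
  "ssc_terminates A \<Omega> L xbar g \<longleftrightarrow>
     \<not> (\<exists>y :: nat \<Rightarrow> 'a. y 0 = xbar \<and> (\<forall>j. ssc_continue A \<Omega> L xbar g (y j) (y (Suc j))))"

definition ssc_sequence ::
  "('a::euclidean_space \<Rightarrow> 'a \<Rightarrow> 'a set) \<Rightarrow> 'a set \<Rightarrow> real \<Rightarrow> ('a \<Rightarrow> real) \<Rightarrow> (nat \<Rightarrow> 'a) \<Rightarrow> bool" where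
  "ssc_sequence A \<Omega> L f x \<longleftrightarrow>
     x 0 \<in> \<Omega> \<and>
     (\<forall>k. if stationary \<Omega> f (x k) then x (Suc k) = x k
          else x (Suc k) \<in> SSC A \<Omega> L (x k) (- grad f (x k)))"

end

theory Submission
  imports Defs
begin

text \<open>
  One call of the procedure from \<open>x\<close> returns a point \<open>z\<close> with two properties. First, \<open>z\<close> lies in the
  ball on which the quadratic upper model of \<open>f\<close> guarantees
  \<open>f z \<le> f x - L / 2 * (norm (z - x))\<^sup>2\<close>. Second, the call does not stop early: there is an iterate \<open>s\<close> of
  the call with \<open>f z \<le> f s \<le> f x\<close> whose criticality measure is at most
  \<open>L * (1 + \<tau>) / \<tau> * norm (z - x)\<close>. Indeed, the angle condition bounds the criticality measure for the
  gradient at \<open>x\<close> by the slope along the chosen direction divided by \<open>\<tau>\<close>, and a run ends only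
  at a critical point or when one of the two balls blocks the next step. The radius of the second ball is the
  last slope divided by \<open>L\<close>; being blocked by the first ball means
  \<open>L * (norm (z - x))\<^sup>2 = - grad f x \<bullet> (z - x)\<close>, and the right-hand side is at least the smallest slope of
  the run times \<open>norm (z - x)\<close>. In either blocked case some slope of the run is at most \<open>L * norm (z - x)\<close>. This
  is \<open>SSC_good_step\<close>; it rests on the invariant \<open>ssc_invariant\<close>, which records the smallest slope.

  The error bound at \<open>s\<close> turns these properties into
  \<open>f z - c \<le> q * (f x - c)\<close>, where \<open>c\<close> is the value at the given stationary point
  (\<open>good_step_contraction\<close>). Both the decrease and the
  contraction enter the path length: \<open>norm (z - x) \<le> sqrt (2 / L) * sqrt (f x - f z)\<close>, and the last factor
  is at most a constant times \<open>sqrt (f x - c) - sqrt (f z - c)\<close> (\<open>sqrt_diff_le_diff_sqrt\<close>), which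
  telescopes. So the whole path from \<open>x 0\<close> is short if \<open>f (x 0) - c\<close> is small, the iterates and the
  points \<open>s\<close> never leave the ball on which the error bound holds, and the sequence is Cauchy with the
  claimed rate (\<open>good_steps_linear_convergence\<close>). The limit is stationary because the criticality
  measures at the points \<open>s\<close> tend to zero (\<open>limit_stationary\<close>).
\<close>

section \<open>Gradients and descent along segments\<close>

lemma GDERIV_unique:
  fixes f :: "'a::euclidean_space \<Rightarrow> real"
  assumes "GDERIV f x :> D" "GDERIV f x :> D'"
  shows "D = D'"
proof -
  have "(\<lambda>h. h \<bullet> D) = (\<lambda>h. h \<bullet> D')"
    using assms has_derivative_unique unfolding gderiv_def by blast
  then show ?thesis
    by (metis inner_commute vector_eq_rdot)
qed

lemma GDERIV_grad:
  fixes f :: "'a::euclidean_space \<Rightarrow> real"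
  assumes "f differentiable (at x)"
  shows "GDERIV f x :> grad f x"
proof -
  obtain f' where f': "(f has_derivative f') (at x)"
    using assms unfolding differentiable_def by blast
  then have "linear f'"
    by (rule has_derivative_linear)
  then have "f' = (\<lambda>h. h \<bullet> adjoint f' 1)"
    by (simp add: adjoint_works)
  with f' have "GDERIV f x :> adjoint f' 1"
    unfolding gderiv_def by simp
  then show ?thesis
    unfolding grad_def using GDERIV_unique theI by metis
qed

lemma C1_near_GDERIV:
  assumes "C1_near \<Omega> f" "x \<in> \<Omega>"
  shows "GDERIV f x :> grad f x"
  using assms GDERIV_grad unfolding C1_near_def by blast

lemma GDERIV_imp_isCont: "GDERIV f x :> D \<Longrightarrow> isCont f x"
  unfolding gderiv_def by (rule has_derivative_continuous)

lemma DERIV_along_line: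
  fixes f :: "'a::euclidean_space \<Rightarrow> real"
  assumes "GDERIV f (y + t *\<^sub>R d) :> D"
  shows "((\<lambda>t. f (y + t *\<^sub>R d)) has_real_derivative d \<bullet> D) (at t)"
proof -
  have "((\<lambda>t. y + t *\<^sub>R d) has_derivative (\<lambda>h. h *\<^sub>R d)) (at t)"
    by (auto intro!: derivative_eq_intros)
  from has_derivative_compose[OF this assms[unfolded gderiv_def]]
  show ?thesis
    unfolding has_field_derivative_def by (simp add: mult_commute_abs)
qed

lemma nonincreasing_along_line:
  fixes f :: "'a::euclidean_space \<Rightarrow> real"
  assumes "0 \<le> a"
    and "\<And>t. 0 \<le> t \<Longrightarrow> t \<le> a \<Longrightarrow> GDERIV f (y + t *\<^sub>R d) :> grad f (y + t *\<^sub>R d)"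
    and "\<And>t. 0 \<le> t \<Longrightarrow> t \<le> a \<Longrightarrow> d \<bullet> grad f (y + t *\<^sub>R d) \<le> 0"
  shows "f (y + a *\<^sub>R d) \<le> f y"
proof -
  have "f (y + 0 *\<^sub>R d) \<ge> f (y + a *\<^sub>R d)"
    by (rule DERIV_nonpos_imp_nonincreasing[OF assms(1)])
      (use assms(2,3) DERIV_along_line in blast)
  then show ?thesis by simp
qed

text \<open>The quadratic upper model has the larger slope at every point of the segment, because
  the gradient turns by at most \<open>L\<close> times the distance travelled.\<close>

lemma descent_inequality:
  fixes f :: "'a::euclidean_space \<Rightarrow> real"
  assumes "convex \<Omega>" "C1_near \<Omega> f" "L-lipschitz_on \<Omega> (grad f)" "x \<in> \<Omega>" "y \<in> \<Omega>"
  shows "f y \<le> f x + grad f x \<bullet> (y - x) + L / 2 * (norm (y - x))\<^sup>2"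
proof -
  define d where "d = y - x"
  define \<phi> where "\<phi> t = f (x + t *\<^sub>R d) - t * (grad f x \<bullet> d) - L / 2 * t\<^sup>2 * (norm d)\<^sup>2" for t
  have "\<phi> 0 \<ge> \<phi> 1"
  proof (rule DERIV_nonpos_imp_nonincreasing[where f = \<phi> and a = 0 and b = 1])
    fix t :: real assume t: "0 \<le> t" "t \<le> 1"
    let ?D = "grad f (x + t *\<^sub>R d)"
    have "x + t *\<^sub>R d = (1 - t) *\<^sub>R x + t *\<^sub>R y"
      by (simp add: d_def algebra_simps)
    then have mem: "x + t *\<^sub>R d \<in> \<Omega>"
      using assms(1,4,5) t by (simp add: convex_alt)
    have der: "(\<phi> has_real_derivative d \<bullet> ?D - grad f x \<bullet> d - L * t * (norm d)\<^sup>2) (at t)"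
      unfolding \<phi>_def
      using DERIV_along_line[OF C1_near_GDERIV[OF assms(2) mem]]
      by (auto intro!: derivative_eq_intros)
    have "d \<bullet> ?D - grad f x \<bullet> d = d \<bullet> (?D - grad f x)"
      by (simp add: inner_diff_right inner_commute)
    also have "\<dots> \<le> norm d * norm (?D - grad f x)"
      by (rule norm_cauchy_schwarz)
    also have "\<dots> \<le> norm d * (L * (t * norm d))"
      using lipschitz_onD[OF assms(3) mem assms(4)] t
      by (intro mult_left_mono) (auto simp: dist_norm)
    finally have "d \<bullet> ?D - grad f x \<bullet> d - L * t * (norm d)\<^sup>2 \<le> 0"
      by (simp add: power2_eq_square mult_ac)
    with der show "\<exists>z. (\<phi> has_real_derivative z) (at t) \<and> z \<le> 0"
      by blast
  qed simp
  then show ?thesis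
    by (simp add: \<phi>_def d_def)
qed

section \<open>The projection onto the tangent cone\<close>

lemma convex_shorten_step:
  assumes "convex S" "y \<in> S" "y + b *\<^sub>R d \<in> S" "0 \<le> t" "t \<le> b"
  shows "y + t *\<^sub>R d \<in> S"
proof (cases "b = 0")
  case False
  have "y + t *\<^sub>R d = (1 - t / b) *\<^sub>R y + (t / b) *\<^sub>R (y + b *\<^sub>R d)"
    using False by (simp add: algebra_simps)
  then show ?thesis
    using assms False by (simp add: convex_alt)
qed (use assms in auto)

text \<open>Two feasible directions have a common feasible step size, because feasible steps may be
  shortened. This is what makes the cone closed under addition.\<close>

lemma convex_cone_feasible_directions:
  assumes "convex \<Omega>" "x \<in> \<Omega>"
  shows "convex_cone (feasible_directions \<Omega> x)"
proof -
  have "v + w \<in> feasible_directions \<Omega> x"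
    if "v \<in> feasible_directions \<Omega> x" "w \<in> feasible_directions \<Omega> x" for v w
  proof -
    obtain a b where ab: "a > 0" "x + a *\<^sub>R v \<in> \<Omega>" "b > 0" "x + b *\<^sub>R w \<in> \<Omega>"
      using \<open>v \<in> _\<close> \<open>w \<in> _\<close> unfolding feasible_directions_def by blast
    define t where "t = min a b"
    have t: "t > 0" "x + t *\<^sub>R v \<in> \<Omega>" "x + t *\<^sub>R w \<in> \<Omega>"
      using ab by (auto simp: t_def intro: convex_shorten_step[OF assms])
    have "x + (t / 2) *\<^sub>R (v + w) = (1/2) *\<^sub>R (x + t *\<^sub>R v) + (1/2) *\<^sub>R (x + t *\<^sub>R w)"
      by (simp add: algebra_simps flip: scaleR_left.add scaleR_add_left)
    also have "\<dots> \<in> \<Omega>"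
      using assms(1) t by (intro convexD) auto
    finally show ?thesis
      unfolding feasible_directions_def using t(1) by (auto intro!: exI[of _ "t / 2"])
  qed
  moreover have "c *\<^sub>R w \<in> feasible_directions \<Omega> x"
    if "w \<in> feasible_directions \<Omega> x" "c \<ge> 0" for w c
  proof (cases "c = 0")
    case True
    then show ?thesis
      using assms(2) by (auto simp: feasible_directions_def intro: exI[of _ 1])
  next
    case False
    obtain t where "t > 0" "x + t *\<^sub>R w \<in> \<Omega>"
      using \<open>w \<in> _\<close> unfolding feasible_directions_def by blast
    then show ?thesis
      using False \<open>c \<ge> 0\<close> by (auto simp: feasible_directions_def intro!: exI[of _ "t / c"])
  qed
  moreover have "0 \<in> feasible_directions \<Omega> x"
    using assms(2) by (auto simp: feasible_directions_def intro: exI[of _ 1])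
  ultimately show ?thesis
    by (auto simp: convex_cone_iff)
qed

lemma diff_in_tangent_cone:
  assumes "z \<in> \<Omega>"
  shows "z - x \<in> tangent_cone \<Omega> x"
proof -
  have "z - x \<in> feasible_directions \<Omega> x"
    using assms by (auto simp: feasible_directions_def intro!: exI[of _ 1])
  then show ?thesis
    unfolding tangent_cone_def using closure_subset by blast
qed

lemma convex_cone_tangent_cone:
  assumes "convex \<Omega>" "x \<in> \<Omega>"
  shows "convex_cone (tangent_cone \<Omega> x)"
  using convex_cone_feasible_directions[OF assms] unfolding tangent_cone_def
  by (simp add: convex_cone_def conic_closure)

lemma proj_norm_nonneg [simp]: "proj_norm \<Omega> x g \<ge> 0"
  by (simp add: proj_norm_def)

lemma proj_norm_le_add_norm_diff:
  assumes "convex \<Omega>" "x \<in> \<Omega>"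
  shows "proj_norm \<Omega> x h \<le> proj_norm \<Omega> x g + norm (h - g)"
proof -
  let ?T = "tangent_cone \<Omega> x"
  have "norm (closest_point ?T h - closest_point ?T g) \<le> norm (h - g)"
    using convex_cone_tangent_cone[OF assms]
      closest_point_lipschitz[of ?T h g] by (simp add: convex_cone_def tangent_cone_def dist_norm)
  then show ?thesis
    unfolding proj_norm_def by norm
qed

text \<open>The residual \<open>g - P\<close> of the projection \<open>P\<close> of \<open>g\<close> onto the tangent cone has a nonpositive
  product with \<open>v - P\<close> for each \<open>v\<close> in the cone; the choice \<open>v = P + w\<close> turns this into
  \<open>g \<bullet> w \<le> P \<bullet> w\<close>.\<close>

lemma inner_le_proj_norm_mult_norm:
  assumes "convex \<Omega>" "x \<in> \<Omega>" "w \<in> tangent_cone \<Omega> x"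
  shows "g \<bullet> w \<le> proj_norm \<Omega> x g * norm w"
proof -
  let ?T = "tangent_cone \<Omega> x"
  let ?P = "closest_point ?T g"
  have T: "convex_cone ?T" "closed ?T"
    using convex_cone_tangent_cone[OF assms(1,2)] by (auto simp: tangent_cone_def)
  then have "?P \<in> ?T"
    by (intro closest_point_in_set) (auto simp: convex_cone_def)
  then have "?P + w \<in> ?T"
    using T(1) assms(3) convex_cone_add by blast
  then have "(g - ?P) \<bullet> (?P + w - ?P) \<le> 0"
    using T by (intro closest_point_dot) (auto simp: convex_cone_def)
  then have "g \<bullet> w \<le> ?P \<bullet> w"
    by (simp add: inner_diff_left)
  also have "\<dots> \<le> norm ?P * norm w"
    by (rule norm_cauchy_schwarz)
  finally show ?thesis
    by (simp add: proj_norm_def)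
qed

text \<open>This is the first-order optimality condition: the half space \<open>{w. g \<bullet> w \<le> 0}\<close> is closed, so
  it contains the tangent cone as soon as it contains all directions towards points of the set,
  and then \<open>0\<close> is the point of the cone nearest to \<open>g\<close>.\<close>

lemma proj_norm_eq_0I:
  assumes "convex \<Omega>" "x \<in> \<Omega>" "\<And>z. z \<in> \<Omega> \<Longrightarrow> g \<bullet> (z - x) \<le> 0"
  shows "proj_norm \<Omega> x g = 0"
proof -
  let ?T = "tangent_cone \<Omega> x"
  let ?P = "closest_point ?T g"
  have T: "convex_cone ?T" "closed ?T"
    using convex_cone_tangent_cone[OF assms(1,2)] by (auto simp: tangent_cone_def)
  have "feasible_directions \<Omega> x \<subseteq> {w. g \<bullet> w \<le> 0}"
  proof
    fix w assume "w \<in> feasible_directions \<Omega> x"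
    then obtain t where t: "t > 0" "x + t *\<^sub>R w \<in> \<Omega>"
      unfolding feasible_directions_def by blast
    from assms(3)[OF t(2)] have "t * (g \<bullet> w) \<le> 0"
      by simp
    with t(1) show "w \<in> {w. g \<bullet> w \<le> 0}"
      by (simp add: mult_le_0_iff)
  qed
  then have sub: "?T \<subseteq> {w. g \<bullet> w \<le> 0}"
    unfolding tangent_cone_def by (intro closure_minimal closed_halfspace_le)
  have P: "?P \<in> ?T"
    using T by (intro closest_point_in_set) (auto simp: convex_cone_def)
  have "0 \<in> ?T"
    using T(1) by (simp add: convex_cone_iff)
  then have "(g - ?P) \<bullet> (0 - ?P) \<le> 0"
    using T by (intro closest_point_dot) (auto simp: convex_cone_def)
  then have "?P \<bullet> ?P \<le> g \<bullet> ?P"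
    by (simp add: inner_diff_left)
  also have "\<dots> \<le> 0"
    using sub P by blast
  finally have "?P \<bullet> ?P = 0"
    by (intro antisym inner_ge_zero)
  then show ?thesis
    by (simp add: proj_norm_def)
qed

section \<open>The angle condition\<close>

lemma method_direction:
  assumes "is_method \<Omega> A" "y \<in> \<Omega>" "d \<in> A y g"
  shows "d \<in> feasible_directions \<Omega> y"
    and "g \<bullet> d \<ge> 0"
    and "d = 0 \<Longrightarrow> proj_norm \<Omega> y g = 0"
    and "d \<noteq> 0 \<Longrightarrow> proj_norm \<Omega> y g \<noteq> 0"
    and "d \<noteq> 0 \<Longrightarrow> g \<bullet> d > 0"
proof -
  have *: "A y g \<subseteq> feasible_directions \<Omega> y"
    "A y g \<subseteq> (tangent_cone \<Omega> y \<inter> {d. g \<bullet> d > 0}) \<union> {0}"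
    "proj_norm \<Omega> y g = 0 \<Longrightarrow> A y g = {0}"
    "proj_norm \<Omega> y g \<noteq> 0 \<Longrightarrow> 0 \<notin> A y g"
    using assms(1,2) unfolding is_method_def by blast+
  show "d \<in> feasible_directions \<Omega> y" "d = 0 \<Longrightarrow> proj_norm \<Omega> y g = 0"
    "d \<noteq> 0 \<Longrightarrow> proj_norm \<Omega> y g \<noteq> 0" "d \<noteq> 0 \<Longrightarrow> g \<bullet> d > 0"
    using * assms(3) by auto
  then show "g \<bullet> d \<ge> 0"
    by (cases "d = 0") auto
qed

lemma DSB_nonneg:
  assumes "is_method \<Omega> A" "x \<in> \<Omega>"
  shows "DSB A \<Omega> x g \<ge> 0"
proof (cases "proj_norm \<Omega> x g = 0")
  case False
  then have "A x g \<noteq> {}"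
    using assms unfolding is_method_def by blast
  then show ?thesis
    using False method_direction(2)[OF assms] unfolding DSB_def by (auto intro!: cINF_greatest)
qed (simp add: DSB_def)

lemma angle_condition:
  assumes "is_method \<Omega> A" "y \<in> \<Omega>" "d \<in> A y g" "d \<noteq> 0"
  shows "SB A \<Omega> * proj_norm \<Omega> y g \<le> g \<bullet> sgn d"
proof -
  have \<pi>: "proj_norm \<Omega> y g \<noteq> 0"
    using method_direction(4) assms by blast
  have "SB A \<Omega> \<le> DSB A \<Omega> y g"
    unfolding SB_def
    using cINF_lower[of "\<lambda>(x, g). DSB A \<Omega> x g" "\<Omega> \<times> UNIV" "(y, g)"]
      DSB_nonneg[OF assms(1)] assms(2) by (force intro!: bdd_belowI[of _ 0])
  also have "\<dots> \<le> (g \<bullet> d) / (proj_norm \<Omega> y g * norm d)"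
    unfolding DSB_def using \<pi> assms(3) method_direction(2)[OF assms(1,2)]
    by (auto intro!: cINF_lower bdd_belowI[of _ 0])
  finally have "SB A \<Omega> * (proj_norm \<Omega> y g * norm d) \<le> g \<bullet> d"
    using \<pi> assms(4) by (simp add: pos_le_divide_eq less_le)
  then show ?thesis
    using assms(4) by (simp add: sgn_div_norm field_simps)
qed

section \<open>Greatest step sizes\<close>

text \<open>The admissible step sizes form a compact set of reals, so the \<open>GREATEST\<close> in the definition
  of the step sizes is attained. The last clause holds because a step that ends in the interior can
  be prolonged.\<close>

lemma Greatest_step:
  fixes y d :: "'a::euclidean_space"
  assumes "compact K" "y \<in> K" "d \<noteq> 0"
  defines "b \<equiv> GREATEST b. 0 \<le> b \<and> y + b *\<^sub>R d \<in> K"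
  shows "0 \<le> b" "y + b *\<^sub>R d \<in> K" "\<And>c. 0 \<le> c \<Longrightarrow> y + c *\<^sub>R d \<in> K \<Longrightarrow> c \<le> b"
    "y + b *\<^sub>R d \<notin> interior K"
proof -
  let ?S = "{b. 0 \<le> b \<and> y + b *\<^sub>R d \<in> K}"
  have "closed ?S"
  proof -
    have "closed ((\<lambda>b. y + b *\<^sub>R d) -` K)"
      using assms(1) by (intro continuous_closed_vimage compact_imp_closed continuous_intros)
    then have "closed ({0..} \<inter> (\<lambda>b. y + b *\<^sub>R d) -` K)"
      by (intro closed_Int) auto
    then show ?thesis
      by (simp add: Int_def)
  qed
  moreover have "bounded ?S"
  proof -
    obtain B where B: "\<And>z. z \<in> K \<Longrightarrow> norm z \<le> B"
      using compact_imp_bounded[OF assms(1)] bounded_iff by blast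
    have "\<bar>b\<bar> \<le> (B + norm y) / norm d" if "b \<in> ?S" for b
    proof -
      have "norm (b *\<^sub>R d) \<le> norm (y + b *\<^sub>R d) + norm y"
        using norm_triangle_ineq4[of "y + b *\<^sub>R d" y] by simp
      also have "\<dots> \<le> B + norm y"
        using B that by auto
      finally show ?thesis
        using assms(3) by (simp add: pos_le_divide_eq)
    qed
    then show ?thesis
      unfolding bounded_iff by (metis real_norm_def)
  qed
  moreover have "0 \<in> ?S"
    using assms(2) by simp
  ultimately obtain m where m: "m \<in> ?S" "\<And>c. c \<in> ?S \<Longrightarrow> c \<le> m"
    using compact_attains_sup[of ?S] compact_eq_bounded_closed by blast
  have "b = m"
    unfolding b_def by (rule Greatest_equality) (use m in auto)
  with m show b: "0 \<le> b" "y + b *\<^sub>R d \<in> K" "\<And>c. 0 \<le> c \<Longrightarrow> y + c *\<^sub>R d \<in> K \<Longrightarrow> c \<le> b"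
    by auto
  show "y + b *\<^sub>R d \<notin> interior K"
  proof
    assume "y + b *\<^sub>R d \<in> interior K"
    then obtain e where e: "e > 0" "ball (y + b *\<^sub>R d) e \<subseteq> K"
      unfolding mem_interior by blast
    define c where "c = b + e / (2 * norm d)"
    have c: "c > b"
      using e(1) assms(3) by (simp add: c_def)
    have "dist (y + b *\<^sub>R d) (y + c *\<^sub>R d) = norm ((c - b) *\<^sub>R d)"
      by (simp add: dist_norm norm_minus_commute algebra_simps)
    also have "\<dots> = e / 2"
      using e(1) assms(3) by (simp add: c_def)
    finally have "y + c *\<^sub>R d \<in> K"
      using e by auto
    with b(1) b(3)[of c] c show False
      by simp
  qed
qed

lemma max_step_eq_Greatest:
  assumes "convex \<Omega>" "y \<in> \<Omega>"
  shows "max_step \<Omega> y d = (GREATEST b. 0 \<le> b \<and> y + b *\<^sub>R d \<in> \<Omega>)"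
proof -
  have "y + t *\<^sub>R d \<in> \<Omega>" if "0 \<le> t" "t \<le> b" "y + b *\<^sub>R d \<in> \<Omega>" for t b
    using convex_shorten_step[OF assms] that by blast
  then have "(0 \<le> b \<and> (\<forall>t\<in>{0..b}. y + t *\<^sub>R d \<in> \<Omega>)) = (0 \<le> b \<and> y + b *\<^sub>R d \<in> \<Omega>)" for b
    by auto
  then show ?thesis
    unfolding max_step_def by simp
qed

lemma
  assumes "compact \<Omega>" "convex \<Omega>" "y \<in> \<Omega>" "d \<noteq> 0"
  shows max_step_nonneg: "0 \<le> max_step \<Omega> y d"
    and max_step_mem: "y + max_step \<Omega> y d *\<^sub>R d \<in> \<Omega>"
    and max_step_greatest: "0 \<le> c \<Longrightarrow> y + c *\<^sub>R d \<in> \<Omega> \<Longrightarrow> c \<le> max_step \<Omega> y d"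
  using Greatest_step(1-3)[OF assms(1,3,4)] max_step_eq_Greatest[OF assms(2,3)] by metis+

lemma max_step_pos:
  assumes "compact \<Omega>" "convex \<Omega>" "y \<in> \<Omega>" "d \<noteq> 0" "d \<in> feasible_directions \<Omega> y"
  shows "max_step \<Omega> y d > 0"
  using assms(5) max_step_greatest[OF assms(1-4)] unfolding feasible_directions_def
  by (force intro: less_le_trans)

section \<open>The trust region of the procedure\<close>

text \<open>Completing the square: the sphere that bounds the first ball passes through \<open>x\<close> and
  \<open>x + g / L\<close>, and the ball collects the points at which the quadratic upper model guarantees the
  decrease \<open>L / 2 * (norm (w - x))\<^sup>2\<close>.\<close>

lemma norm_diff_half_gradient:
  fixes x g w :: "'a::real_inner"
  assumes "L > 0"
  shows "(norm (x + (1 / (2 * L)) *\<^sub>R g - w))\<^sup>2 - (norm g / (2 * L))\<^sup>2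
    = (L * (norm (w - x))\<^sup>2 - g \<bullet> (w - x)) / L"
proof -
  let ?u = "(1 / (2 * L)) *\<^sub>R g" and ?v = "w - x"
  have "(norm (x + ?u - w))\<^sup>2 = (norm (?u - ?v))\<^sup>2"
    by (simp add: algebra_simps)
  also have "\<dots> = (norm ?u)\<^sup>2 - 2 * (?u \<bullet> ?v) + (norm ?v)\<^sup>2"
    unfolding power2_norm_eq_inner inner_diff_left inner_diff_right
    by (simp add: inner_commute algebra_simps)
  also have "\<dots> = (norm g / (2 * L))\<^sup>2 - (g \<bullet> ?v) / L + (norm ?v)\<^sup>2"
    using assms by simp
  finally show ?thesis
    using assms by (simp add: diff_divide_distrib)
qed

lemma mem_model_ball:
  fixes x g w :: "'a::euclidean_space"
  assumes "L > 0"
  shows "w \<in> cball (x + (1 / (2 * L)) *\<^sub>R g) (norm g / (2 * L))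
      \<longleftrightarrow> L * (norm (w - x))\<^sup>2 \<le> g \<bullet> (w - x)"
    and "w \<in> ball (x + (1 / (2 * L)) *\<^sub>R g) (norm g / (2 * L))
      \<longleftrightarrow> L * (norm (w - x))\<^sup>2 < g \<bullet> (w - x)"
proof -
  let ?a = "norm (x + (1 / (2 * L)) *\<^sub>R g - w)" and ?r = "norm g / (2 * L)"
  let ?E = "L * (norm (w - x))\<^sup>2 - g \<bullet> (w - x)"
  have E: "?a\<^sup>2 - ?r\<^sup>2 = ?E / L"
    by (rule norm_diff_half_gradient[OF assms])
  have r: "0 \<le> ?r"
    using assms by simp
  have "?a \<le> ?r \<longleftrightarrow> ?a\<^sup>2 - ?r\<^sup>2 \<le> 0"
    using abs_le_square_iff[of ?a ?r] r by simp
  also have "\<dots> \<longleftrightarrow> ?E \<le> 0"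
    unfolding E using assms by (simp add: divide_le_0_iff)
  finally show "w \<in> cball (x + (1 / (2 * L)) *\<^sub>R g) (norm g / (2 * L))
      \<longleftrightarrow> L * (norm (w - x))\<^sup>2 \<le> g \<bullet> (w - x)"
    by (simp add: dist_norm)
  have "?a < ?r \<longleftrightarrow> ?a\<^sup>2 - ?r\<^sup>2 < 0"
    using abs_le_square_iff[of ?r ?a] r by (simp add: not_le[symmetric])
  also have "\<dots> \<longleftrightarrow> ?E < 0"
    unfolding E using assms by (simp add: divide_less_0_iff)
  finally show "w \<in> ball (x + (1 / (2 * L)) *\<^sub>R g) (norm g / (2 * L))
      \<longleftrightarrow> L * (norm (w - x))\<^sup>2 < g \<bullet> (w - x)"
    by (simp add: dist_norm)
qed

lemma
  fixes x g d w :: "'a::euclidean_space"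
  assumes "L > 0"
  shows mem_ssc_region: "w \<in> ssc_region L x g d
      \<longleftrightarrow> L * (norm (w - x))\<^sup>2 \<le> g \<bullet> (w - x) \<and> L * norm (w - x) \<le> g \<bullet> sgn d"
    and mem_interior_ssc_region: "w \<in> interior (ssc_region L x g d)
      \<longleftrightarrow> L * (norm (w - x))\<^sup>2 < g \<bullet> (w - x) \<and> L * norm (w - x) < g \<bullet> sgn d"
proof -
  have "w \<in> cball x ((g \<bullet> sgn d) / L) \<longleftrightarrow> L * norm (w - x) \<le> g \<bullet> sgn d"
    "w \<in> ball x ((g \<bullet> sgn d) / L) \<longleftrightarrow> L * norm (w - x) < g \<bullet> sgn d"
    using assms by (auto simp: dist_norm norm_minus_commute field_simps)
  then show "w \<in> ssc_region L x g d
      \<longleftrightarrow> L * (norm (w - x))\<^sup>2 \<le> g \<bullet> (w - x) \<and> L * norm (w - x) \<le> g \<bullet> sgn d"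
    "w \<in> interior (ssc_region L x g d)
      \<longleftrightarrow> L * (norm (w - x))\<^sup>2 < g \<bullet> (w - x) \<and> L * norm (w - x) < g \<bullet> sgn d"
    unfolding ssc_region_def interior_Int interior_cball Int_iff mem_model_ball[OF assms] by simp_all
qed

lemma compact_ssc_region: "compact (ssc_region L x g d)"
  unfolding ssc_region_def by (intro compact_Int compact_cball)

lemma convex_ssc_region: "convex (ssc_region L x g d)"
  unfolding ssc_region_def by (intro convex_Int convex_cball)

lemma
  fixes y d :: "'a::euclidean_space"
  assumes "y \<in> ssc_region L x g d" "d \<noteq> 0"
  shows ssc_beta_nonneg: "0 \<le> ssc_beta L x g y d"
    and ssc_beta_mem: "y + ssc_beta L x g y d *\<^sub>R d \<in> ssc_region L x g d"
    and ssc_beta_greatest: "0 \<le> c \<Longrightarrow> y + c *\<^sub>R d \<in> ssc_region L x g d \<Longrightarrow> c \<le> ssc_beta L x g y d"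
    and ssc_beta_not_interior: "y + ssc_beta L x g y d *\<^sub>R d \<notin> interior (ssc_region L x g d)"
  using Greatest_step[OF compact_ssc_region assms] assms(1) unfolding ssc_beta_def by simp_all

text \<open>The minimiser \<open>(g \<bullet> d) / (L * (norm d)\<^sup>2)\<close> of the quadratic upper model along \<open>d\<close> is a
  positive step that ends on both spheres.\<close>

lemma ssc_beta_pos_at_centre:
  fixes x g d :: "'a::euclidean_space"
  assumes "L > 0" "g \<bullet> d > 0"
  shows "x \<in> ssc_region L x g d" and "ssc_beta L x g x d > 0"
proof -
  have d: "d \<noteq> 0"
    using assms(2) by auto
  have gd: "g \<bullet> sgn d > 0"
    using assms(2) d by (simp add: sgn_div_norm)
  show mem: "x \<in> ssc_region L x g d"
    using assms(1) gd by (simp add: mem_ssc_region)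
  define b where "b = (g \<bullet> d) / (L * (norm d)\<^sup>2)"
  have b: "b > 0"
    using assms d by (simp add: b_def)
  have "x + b *\<^sub>R d \<in> ssc_region L x g d"
    using assms b d gd
    by (simp add: mem_ssc_region power_mult_distrib)
      (simp add: b_def sgn_div_norm field_simps power2_eq_square)
  then have "b \<le> ssc_beta L x g x d"
    using b by (intro ssc_beta_greatest[OF mem d]) auto
  with b show "ssc_beta L x g x d > 0"
    by simp
qed

section \<open>One call of the procedure\<close>

locale ssc_setting =
  fixes \<Omega> :: "'a::euclidean_space set" and f :: "'a \<Rightarrow> real"
    and A :: "'a \<Rightarrow> 'a \<Rightarrow> 'a set" and L \<tau> :: real
  assumes compact_\<Omega>: "compact \<Omega>" and convex_\<Omega>: "convex \<Omega>"
    and C1: "C1_near \<Omega> f" and L_pos: "L > 0" and lipschitz: "L-lipschitz_on \<Omega> (grad f)"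
    and A_method: "is_method \<Omega> A" and SB_eq: "SB A \<Omega> = \<tau>" and \<tau>_pos: "\<tau> > 0"
begin

lemma angle:
  assumes "y \<in> \<Omega>" "d \<in> A y g" "d \<noteq> 0"
  shows "\<tau> * proj_norm \<Omega> y g \<le> g \<bullet> sgn d"
  using angle_condition[OF A_method assms] by (simp add: SB_eq)

definition neg_grad :: "'a \<Rightarrow> 'a" where
  "neg_grad x = - grad f x"

lemma norm_neg_grad_diff_le:
  assumes "x \<in> \<Omega>" "y \<in> \<Omega>"
  shows "norm (neg_grad x - neg_grad y) \<le> L * norm (x - y)"
  using lipschitz_onD[OF lipschitz assms]
  by (simp add: neg_grad_def dist_norm norm_minus_commute)

text \<open>The second ball is made for this: as long as \<open>L * norm (y - x)\<close> stays below the slope of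
  \<open>neg_grad x\<close> along \<open>d\<close>, the gradient has not turned enough to make \<open>d\<close> an ascent direction.\<close>

lemma nonincreasing_in_ssc_region:
  assumes "x \<in> \<Omega>" "y \<in> \<Omega>" "y + a *\<^sub>R d \<in> \<Omega>" "0 \<le> a"
    and "y \<in> ssc_region L x (neg_grad x) d" "y + a *\<^sub>R d \<in> ssc_region L x (neg_grad x) d"
  shows "f (y + a *\<^sub>R d) \<le> f y"
proof (rule nonincreasing_along_line[OF assms(4)])
  fix t assume t: "0 \<le> t" "t \<le> a"
  let ?z = "y + t *\<^sub>R d"
  have z: "?z \<in> \<Omega>" "?z \<in> ssc_region L x (neg_grad x) d"
    using convex_shorten_step[OF convex_\<Omega> assms(2,3) t]
      convex_shorten_step[OF convex_ssc_region assms(5,6) t] by auto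
  show "GDERIV f ?z :> grad f ?z"
    by (rule C1_near_GDERIV[OF C1 z(1)])
  have "(neg_grad x - neg_grad ?z) \<bullet> sgn d \<le> norm (neg_grad x - neg_grad ?z) * norm (sgn d)"
    by (rule norm_cauchy_schwarz)
  also have "\<dots> \<le> norm (neg_grad ?z - neg_grad x) * 1"
    by (intro mult_mono) (auto simp: norm_minus_commute norm_sgn)
  also have "\<dots> \<le> L * norm (?z - x)"
    using norm_neg_grad_diff_le[OF z(1) assms(1)] by simp
  also have "\<dots> \<le> neg_grad x \<bullet> sgn d"
    using z(2) by (simp add: mem_ssc_region[OF L_pos])
  finally have "neg_grad ?z \<bullet> sgn d \<ge> 0"
    by (simp add: inner_diff_left)
  then show "d \<bullet> grad f ?z \<le> 0"
    by (cases "d = 0") (auto simp: neg_grad_def sgn_div_norm inner_commute mult_le_0_iff)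
qed

text \<open>What one call from \<open>x\<close> to \<open>z\<close> achieves. Apart from the decrease of \<open>f\<close> it controls the
  criticality measure, not at \<open>z\<close> itself but at some iterate \<open>s\<close> of the run. The other
  inequalities confine \<open>s\<close> to the region where a local error bound applies.\<close>

definition good_step :: "'a \<Rightarrow> 'a \<Rightarrow> 'a \<Rightarrow> bool" where
  "good_step x z s \<longleftrightarrow> z \<in> \<Omega> \<and> s \<in> \<Omega> \<and>
     f z \<le> f x - L / 2 * (norm (z - x))\<^sup>2 \<and> f z \<le> f s \<and> f s \<le> f x \<and>
     norm (s - x) \<le> norm (z - x) \<and>
     \<tau> * proj_norm \<Omega> s (neg_grad s) \<le> (1 + \<tau>) * L * norm (z - x)"

text \<open>The criticality measure for the gradient at \<open>x\<close>, which a run keeps fixed, transfers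
  to the one for the gradient at \<open>s\<close> at the price of \<open>L * norm (s - x)\<close>; this is where \<open>1 + \<tau>\<close> comes from.\<close>

lemma good_stepI:
  assumes "x \<in> \<Omega>" "z \<in> \<Omega>" "s \<in> \<Omega>"
    and "L * (norm (z - x))\<^sup>2 \<le> neg_grad x \<bullet> (z - x)"
    and "f z \<le> f s" "f s \<le> f x"
    and "L * norm (s - x) \<le> L * norm (z - x)"
    and "\<tau> * proj_norm \<Omega> s (neg_grad x) \<le> L * norm (z - x)"
  shows "good_step x z s"
proof -
  have "f z \<le> f x - neg_grad x \<bullet> (z - x) + L / 2 * (norm (z - x))\<^sup>2"
    using descent_inequality[OF convex_\<Omega> C1 lipschitz assms(1,2)] by (simp add: neg_grad_def)
  also have "\<dots> \<le> f x - L / 2 * (norm (z - x))\<^sup>2"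
    using assms(4) by simp
  finally have decrease: "f z \<le> f x - L / 2 * (norm (z - x))\<^sup>2" .
  have "proj_norm \<Omega> s (neg_grad s) \<le> proj_norm \<Omega> s (neg_grad x) + norm (neg_grad s - neg_grad x)"
    by (rule proj_norm_le_add_norm_diff[OF convex_\<Omega> assms(3)])
  also have "\<dots> \<le> proj_norm \<Omega> s (neg_grad x) + L * norm (z - x)"
    using norm_neg_grad_diff_le[OF assms(3,1)] assms(7) by simp
  finally have "\<tau> * proj_norm \<Omega> s (neg_grad s)
      \<le> \<tau> * (proj_norm \<Omega> s (neg_grad x) + L * norm (z - x))"
    using \<tau>_pos by (intro mult_left_mono) auto
  also have "\<dots> \<le> (1 + \<tau>) * L * norm (z - x)"
    using assms(8) by (simp add: algebra_simps)
  finally show ?thesis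
    using assms decrease L_pos by (simp add: good_step_def)
qed

text \<open>The bookkeeping of a run. A point \<open>y\<close> reached from \<open>x\<close> was reached by steps of total length
  at least \<open>norm (y - x)\<close>, and \<open>m\<close> is the smallest slope of \<open>neg_grad x\<close> along their directions;
  therefore \<open>neg_grad x \<bullet> (y - x) \<ge> m * norm (y - x)\<close>. The point \<open>s\<close> is the iterate at which the
  smallest slope occurred.\<close>

definition slope_witness :: "'a \<Rightarrow> 'a \<Rightarrow> 'a \<Rightarrow> real \<Rightarrow> bool" where
  "slope_witness x y s m \<longleftrightarrow> s \<in> \<Omega> \<and> y \<noteq> x \<and>
     m * norm (y - x) \<le> neg_grad x \<bullet> (y - x) \<and> 0 < neg_grad x \<bullet> (y - x) \<and>
     \<tau> * proj_norm \<Omega> s (neg_grad x) \<le> m \<and> L * norm (s - x) \<le> m \<and> f y \<le> f s \<and> f s \<le> f x"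

definition ssc_invariant :: "'a \<Rightarrow> 'a \<Rightarrow> bool" where
  "ssc_invariant x y \<longleftrightarrow> y \<in> \<Omega> \<and> L * (norm (y - x))\<^sup>2 \<le> neg_grad x \<bullet> (y - x) \<and> f y \<le> f x \<and>
     (y = x \<or> (\<exists>s m. slope_witness x y s m))"

lemma ssc_invariant_step:
  assumes x: "x \<in> \<Omega>" and inv: "ssc_invariant x y"
    and d: "d \<in> A y (neg_grad x)" "d \<noteq> 0" and reg: "y \<in> ssc_region L x (neg_grad x) d"
  defines "z \<equiv> y + ssc_alpha \<Omega> L x (neg_grad x) y d *\<^sub>R d"
  shows "ssc_invariant x z" "f z \<le> f y" "\<exists>s m. slope_witness x z s m"
proof -
  define g where "g = neg_grad x"
  define a where "a = ssc_alpha \<Omega> L x (neg_grad x) y d"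
  have z: "z = y + a *\<^sub>R d"
    by (simp add: z_def a_def)
  have y: "y \<in> \<Omega>" "L * (norm (y - x))\<^sup>2 \<le> g \<bullet> (y - x)" "f y \<le> f x"
    using inv by (auto simp: ssc_invariant_def g_def)
  have reg': "y \<in> ssc_region L x g d"
    using reg by (simp add: g_def)
  note dir = method_direction[OF A_method y(1) d(1)]
  have gd: "g \<bullet> d > 0"
    using dir(5) d(2) by (simp add: g_def)
  have a_min: "a = min (max_step \<Omega> y d) (ssc_beta L x g y d)"
    by (simp add: a_def ssc_alpha_def g_def)
  have a: "0 \<le> a"
    using max_step_nonneg[OF compact_\<Omega> convex_\<Omega> y(1) d(2)] ssc_beta_nonneg[OF reg' d(2)]
    by (simp add: a_min)
  have z\<Omega>: "z \<in> \<Omega>"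
    unfolding z using max_step_mem[OF compact_\<Omega> convex_\<Omega> y(1) d(2)]
    by (rule convex_shorten_step[OF convex_\<Omega> y(1) _ a]) (simp add: a_min)
  have z_reg: "z \<in> ssc_region L x g d"
    unfolding z using ssc_beta_mem[OF reg' d(2)]
    by (rule convex_shorten_step[OF convex_ssc_region reg' _ a]) (simp add: a_min)
  show fz: "f z \<le> f y"
    using nonincreasing_in_ssc_region[OF x y(1) _ a] z\<Omega> z_reg reg' by (simp add: z g_def)
  define c where "c = g \<bullet> sgn d"
  have c: "c > 0" "\<tau> * proj_norm \<Omega> y g \<le> c" "L * norm (y - x) \<le> c"
    using gd d angle[OF y(1)] reg'
    by (auto simp: c_def g_def sgn_div_norm mem_ssc_region[OF L_pos])
  have gz: "g \<bullet> (z - x) = g \<bullet> (y - x) + c * (a * norm d)"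
    using d(2) by (simp add: z c_def sgn_div_norm inner_diff_right inner_add_right)
  have nz: "norm (z - x) \<le> norm (y - x) + a * norm d"
    using norm_triangle_ineq[of "y - x" "a *\<^sub>R d"] a by (simp add: z algebra_simps)
  show wit: "\<exists>s m. slope_witness x z s m"
  proof (cases "y = x")
    case True
    have "a > 0"
      using max_step_pos[OF compact_\<Omega> convex_\<Omega> y(1) d(2) dir(1)] ssc_beta_pos_at_centre(2)[OF L_pos gd]
      by (simp add: a_min True)
    then have "slope_witness x z y c"
      using True y c d(2) fz gz z by (simp add: slope_witness_def g_def)
    then show ?thesis by blast
  next
    case False
    then obtain s m where w: "slope_witness x y s m"
      using inv by (auto simp: ssc_invariant_def)
    then have pos: "g \<bullet> (z - x) > 0"
      using gz c(1) a by (simp add: slope_witness_def g_def add_pos_nonneg)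
    then have neq: "z \<noteq> x"
      by auto
    have lb: "k * norm (z - x) \<le> g \<bullet> (z - x)"
      if k: "k \<le> c" "k \<le> m" "0 \<le> k" for k
    proof -
      have "k * norm (z - x) \<le> k * norm (y - x) + k * (a * norm d)"
        using mult_left_mono[OF nz k(3)] by (simp add: algebra_simps)
      also have "\<dots> \<le> m * norm (y - x) + c * (a * norm d)"
        using k a by (intro add_mono mult_right_mono) auto
      also have "\<dots> \<le> g \<bullet> (z - x)"
        using w gz by (simp add: slope_witness_def g_def)
      finally show ?thesis .
    qed
    have "m \<ge> 0"
    proof -
      have "0 \<le> L * norm (s - x)"
        using L_pos by simp
      then show ?thesis
        using w by (simp add: slope_witness_def)
    qed
    show ?thesis
    proof (cases "c \<le> m")
      case True
      then have "slope_witness x z y c"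
        using y c fz pos neq lb[of c] by (simp add: slope_witness_def g_def)
      then show ?thesis by blast
    next
      case False
      then have "slope_witness x z s m"
        using w fz pos neq lb[of m] \<open>m \<ge> 0\<close> by (simp add: slope_witness_def g_def)
      then show ?thesis by blast
    qed
  qed
  show "ssc_invariant x z"
    using z\<Omega> z_reg fz y(3) wit by (simp add: ssc_invariant_def mem_ssc_region[OF L_pos] g_def)
qed

lemma ssc_invariant_reachable:
  assumes "x \<in> \<Omega>" "(ssc_continue A \<Omega> L x (neg_grad x))\<^sup>*\<^sup>* x y"
  shows "ssc_invariant x y"
  using assms(2)
proof induction
  case base
  show ?case
    using assms(1) by (simp add: ssc_invariant_def)
next
  case (step y z)
  then obtain d where d: "d \<in> A y (neg_grad x)" "d \<noteq> 0"
    and ne: "ssc_alpha \<Omega> L x (neg_grad x) y d \<noteq> ssc_beta L x (neg_grad x) y d"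
    and z: "z = y + ssc_alpha \<Omega> L x (neg_grad x) y d *\<^sub>R d"
    unfolding ssc_continue_def by blast
  have "y \<in> \<Omega>"
    using step.IH by (simp add: ssc_invariant_def)
  \<comment> \<open>Outside the region the second step bound is zero, hence the minimum, and the run ends.\<close>
  have "y \<in> ssc_region L x (neg_grad x) d"
  proof (rule ccontr)
    assume "y \<notin> ssc_region L x (neg_grad x) d"
    then show False
      using ne max_step_nonneg[OF compact_\<Omega> convex_\<Omega> \<open>y \<in> \<Omega>\<close> d(2)]
      by (simp add: ssc_alpha_def ssc_beta_def)
  qed
  then show ?case
    unfolding z using ssc_invariant_step(1)[OF assms(1) step.IH d] by blast
qed

text \<open>Three ways to stop. If \<open>d = 0\<close>, the returned point is critical for the gradient at \<open>x\<close>. If the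
  second ball blocks the run, the moved distance is at least the last slope divided by \<open>L\<close>. If the
  first ball blocks it, then \<open>L * (norm (z - x))\<^sup>2 = neg_grad x \<bullet> (z - x) \<ge> m * norm (z - x)\<close>, and the
  smallest slope \<open>m\<close> takes the part of the last one.\<close>

lemma SSC_good_step:
  assumes x: "x \<in> \<Omega>" and z: "z \<in> SSC A \<Omega> L x (neg_grad x)"
  shows "\<exists>s. good_step x z s"
proof -
  define g where "g = neg_grad x"
  obtain y where run: "(ssc_continue A \<Omega> L x g)\<^sup>*\<^sup>* x y" and ret: "ssc_return A \<Omega> L x g y z"
    using z unfolding SSC_def g_def by blast
  have inv: "ssc_invariant x y"
    using ssc_invariant_reachable[OF x] run by (simp add: g_def)
  then have y: "y \<in> \<Omega>" "L * (norm (y - x))\<^sup>2 \<le> g \<bullet> (y - x)" "f y \<le> f x"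
    by (auto simp: ssc_invariant_def g_def)
  obtain d where d: "d \<in> A y g"
    and cases: "d = 0 \<and> z = y \<or> d \<noteq> 0 \<and> ssc_alpha \<Omega> L x g y d = ssc_beta L x g y d
      \<and> z = y + ssc_alpha \<Omega> L x g y d *\<^sub>R d"
    using ret unfolding ssc_return_def by blast
  consider (critical) "d = 0" "z = y"
    | (outside) "d \<noteq> 0" "y \<notin> ssc_region L x g d"
    | (blocked) "d \<noteq> 0" "y \<in> ssc_region L x g d"
    using cases by blast
  then show ?thesis
  proof cases
    case critical
    then have "good_step x z y"
      using x y method_direction(3)[OF A_method y(1) d] L_pos
      by (intro good_stepI) (auto simp: g_def)
    then show ?thesis by blast
  next
    case outside
    then have "z = y"
      using cases by (simp add: ssc_beta_def)
    moreover have "g \<bullet> sgn d < L * norm (y - x)"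
      using outside y(2) by (auto simp: mem_ssc_region[OF L_pos])
    ultimately have "good_step x z y"
      using x y angle[OF y(1) d outside(1)]
      by (intro good_stepI) (auto simp: g_def)
    then show ?thesis by blast
  next
    case blocked
    have zb: "z = y + ssc_alpha \<Omega> L x g y d *\<^sub>R d" "ssc_alpha \<Omega> L x g y d = ssc_beta L x g y d"
      using cases blocked by auto
    have inv_z: "ssc_invariant x z" "f z \<le> f y" "\<exists>s m. slope_witness x z s m"
      using ssc_invariant_step[OF x inv, of d] d blocked unfolding zb(1) g_def by blast+
    have zx: "z \<in> \<Omega>" "L * (norm (z - x))\<^sup>2 \<le> g \<bullet> (z - x)"
      using inv_z(1) by (auto simp: ssc_invariant_def g_def)
    have "z \<notin> interior (ssc_region L x g d)"
      using ssc_beta_not_interior[OF blocked(2,1)] zb by simp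
    then consider (slope) "g \<bullet> sgn d \<le> L * norm (z - x)"
      | (model) "g \<bullet> (z - x) \<le> L * (norm (z - x))\<^sup>2"
      by (auto simp: mem_interior_ssc_region[OF L_pos])
    then show ?thesis
    proof cases
      case slope
      moreover have "L * norm (y - x) \<le> g \<bullet> sgn d"
        using blocked by (simp add: mem_ssc_region[OF L_pos])
      ultimately have "good_step x z y"
        using x y zx inv_z(2) angle[OF y(1) d blocked(1)]
        by (intro good_stepI) (auto simp: g_def)
      then show ?thesis by blast
    next
      case model
      obtain s m where w: "slope_witness x z s m"
        using inv_z(3) by blast
      then have "m * norm (z - x) \<le> (L * norm (z - x)) * norm (z - x)"
        using model unfolding slope_witness_def g_def power2_eq_square mult.assoc by linarith
      moreover have "norm (z - x) > 0"
        using w by (simp add: slope_witness_def)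
      ultimately have "m \<le> L * norm (z - x)"
        by simp
      then have "good_step x z s"
        using x zx w by (intro good_stepI) (auto simp: g_def slope_witness_def)
      then show ?thesis by blast
    qed
  qed
qed

lemma ssc_sequence_good_steps:
  assumes "ssc_sequence A \<Omega> L f x"
  shows "x k \<in> \<Omega>" and "\<exists>s. good_step (x k) (x (Suc k)) s"
proof -
  have step: "\<exists>s. good_step (x k) (x (Suc k)) s" if "x k \<in> \<Omega>" for k
  proof (cases "stationary \<Omega> f (x k)")
    case True
    then have "x (Suc k) = x k" "proj_norm \<Omega> (x k) (neg_grad (x k)) = 0"
      using assms by (auto simp: ssc_sequence_def stationary_def neg_grad_def)
    then have "good_step (x k) (x (Suc k)) (x k)"
      using that by (simp add: good_step_def)
    then show ?thesis by blast
  next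
    case False
    then have "x (Suc k) \<in> SSC A \<Omega> L (x k) (neg_grad (x k))"
      using assms by (auto simp: ssc_sequence_def neg_grad_def)
    then show ?thesis
      by (rule SSC_good_step[OF that])
  qed
  show mem: "x k \<in> \<Omega>" for k
    by (induction k) (use assms step in \<open>auto simp: ssc_sequence_def good_step_def\<close>)
  show "\<exists>s. good_step (x k) (x (Suc k)) s"
    by (rule step[OF mem])
qed

end

section \<open>Linear convergence\<close>

text \<open>Substituting \<open>b = v\<^sup>2\<close>, \<open>a = u\<^sup>2\<close> and \<open>q = p\<^sup>2\<close> reduces the claim to
  \<open>(u + v) * (1 - p) \<le> (1 + p) * (u - v)\<close>, which says \<open>v \<le> p * u\<close>. Equality holds
  for \<open>b = q * a\<close>, so the geometric decrease is the worst case for the length of the path.\<close>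

lemma sqrt_diff_le_diff_sqrt:
  fixes a b q :: real
  assumes "0 \<le> b" "b \<le> q * a" "0 < q" "q < 1" "0 \<le> a"
  shows "sqrt (a - b) \<le> sqrt (1 - q) / (1 - sqrt q) * (sqrt a - sqrt b)"
proof -
  define u v p where "u = sqrt a" and "v = sqrt b" and "p = sqrt q"
  have sq: "a = u\<^sup>2" "b = v\<^sup>2" "q = p\<^sup>2"
    using assms by (auto simp: u_def v_def p_def)
  have p: "0 < p" "p < 1" and u: "u \<ge> 0"
    using assms by (auto simp: p_def u_def)
  have vpu: "v \<le> p * u"
    using assms(2) unfolding u_def v_def p_def real_sqrt_mult[symmetric] by simp
  have vu: "v \<le> u"
    using vpu p u by (meson less_imp_le mult_left_le_one_le order_trans)
  have "(u + v) * (1 - p) \<le> (1 + p) * (u - v)"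
    using vpu by (simp add: algebra_simps)
  then have "((u + v) * (1 - p)) * ((u - v) * (1 - p)) \<le> ((1 + p) * (u - v)) * ((u - v) * (1 - p))"
    using vu p by (intro mult_right_mono) auto
  then have "(a - b) * (1 - p)\<^sup>2 \<le> (1 - q) * (u - v)\<^sup>2"
    unfolding sq by (simp add: algebra_simps power2_eq_square)
  then have "sqrt ((a - b) * (1 - p)\<^sup>2) \<le> sqrt ((1 - q) * (u - v)\<^sup>2)"
    by (rule real_sqrt_le_mono)
  then have "sqrt (a - b) * (1 - p) \<le> sqrt (1 - q) * (u - v)"
    using p vu by (simp add: real_sqrt_mult)
  then show ?thesis
    using p by (simp add: field_simps flip: u_def v_def p_def)
qed

context ssc_setting
begin

text \<open>With \<open>\<kappa> = \<mu> / L * (\<tau> / (1 + \<tau>))\<^sup>2\<close>, the error bound at \<open>s\<close> and the bound on its criticality measure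
  make the decrease at least \<open>\<kappa> * (f s - c)\<close>, hence at least \<open>\<kappa> * (f z - c)\<close>.\<close>

lemma good_step_contraction:
  assumes step: "good_step x z s" and "c \<le> f z" and "\<mu> > 0"
    and bound: "c < f s \<Longrightarrow> sqrt (2 * \<mu>) * sqrt (f s - c) \<le> proj_norm \<Omega> s (neg_grad s)"
    and q: "q = inverse (1 + \<mu> / L * (\<tau>\<^sup>2 / (1 + \<tau>)\<^sup>2))"
  shows "f z - c \<le> q * (f x - c)"
proof -
  define D where "D = norm (z - x)"
  define \<kappa> where "\<kappa> = \<mu> / L * (\<tau>\<^sup>2 / (1 + \<tau>)\<^sup>2)"
  have \<kappa>: "\<kappa> > 0"
    using \<tau>_pos L_pos \<open>\<mu> > 0\<close> by (simp add: \<kappa>_def)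
  have st: "f z \<le> f x - L / 2 * D\<^sup>2" "f z \<le> f s"
    "\<tau> * proj_norm \<Omega> s (neg_grad s) \<le> (1 + \<tau>) * L * D"
    using step by (auto simp: good_step_def D_def)
  have "\<kappa> * (f z - c) \<le> L / 2 * D\<^sup>2"
  proof (cases "c < f s")
    case True
    have "\<tau> * (sqrt (2 * \<mu>) * sqrt (f s - c)) \<le> \<tau> * proj_norm \<Omega> s (neg_grad s)"
      using bound[OF True] \<tau>_pos by simp
    with st(3) have "\<tau> * (sqrt (2 * \<mu>) * sqrt (f s - c)) \<le> (1 + \<tau>) * L * D"
      by linarith
    then have "(\<tau> * (sqrt (2 * \<mu>) * sqrt (f s - c)))\<^sup>2 \<le> ((1 + \<tau>) * L * D)\<^sup>2"
      using True \<tau>_pos \<open>\<mu> > 0\<close> by (intro power_mono) auto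
    then have *: "\<tau>\<^sup>2 * (2 * \<mu> * (f s - c)) \<le> (1 + \<tau>)\<^sup>2 * (L\<^sup>2 * D\<^sup>2)"
      using True \<open>\<mu> > 0\<close> by (simp add: power_mult_distrib mult.assoc)
    have "\<kappa> * (f z - c) \<le> \<kappa> * (f s - c)"
      using \<kappa> st(2) by simp
    also have "\<kappa> * (f s - c) = \<tau>\<^sup>2 * (2 * \<mu> * (f s - c)) / (2 * L * (1 + \<tau>)\<^sup>2)"
      using L_pos \<tau>_pos by (simp add: \<kappa>_def field_simps)
    also have "\<dots> \<le> (1 + \<tau>)\<^sup>2 * (L\<^sup>2 * D\<^sup>2) / (2 * L * (1 + \<tau>)\<^sup>2)"
      using * L_pos by (intro divide_right_mono) auto
    also have "\<dots> = L / 2 * D\<^sup>2"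
      using L_pos \<tau>_pos by (simp add: power2_eq_square)
    finally show ?thesis .
  next
    case False
    then have "f z = c"
      using st(2) assms(2) by simp
    then show ?thesis
      using L_pos by simp
  qed
  then have "(1 + \<kappa>) * (f z - c) \<le> f x - c"
    using st(1) by (simp add: algebra_simps)
  then have "f z - c \<le> (f x - c) / (1 + \<kappa>)"
    using \<kappa> by (simp add: pos_le_divide_eq mult.commute)
  then show ?thesis
    unfolding q \<kappa>_def[symmetric] by (simp add: divide_inverse mult.commute)
qed

lemma good_step_length:
  assumes "good_step x z s"
  shows "norm (z - x) \<le> sqrt (2 / L) * sqrt (f x - f z)"
proof -
  have "(norm (z - x))\<^sup>2 \<le> 2 / L * (f x - f z)"
    using assms L_pos by (simp add: good_step_def field_simps)
  then show ?thesis
    by (simp add: real_le_rsqrt flip: real_sqrt_mult)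
qed

text \<open>The criticality measures at the points \<open>s k\<close>, which have the same limit, tend to zero. The
  measure itself is not continuous, since the tangent cone jumps; but the inequality
  \<open>neg_grad s \<bullet> (w - s) \<le> proj_norm \<Omega> s (neg_grad s) * norm (w - s)\<close> passes to the limit for every
  \<open>w\<close> in the set.\<close>

lemma limit_stationary:
  assumes steps: "\<And>k. good_step (x k) (x (Suc k)) (s k)" and lim: "x \<longlonglongrightarrow> xt" and "xt \<in> \<Omega>"
  shows "stationary \<Omega> f xt"
proof -
  have s: "s k \<in> \<Omega>" "norm (s k - x k) \<le> norm (x (Suc k) - x k)"
    "\<tau> * proj_norm \<Omega> (s k) (neg_grad (s k)) \<le> (1 + \<tau>) * L * norm (x (Suc k) - x k)" for k
    using steps[of k] by (auto simp: good_step_def)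
  have "(\<lambda>k. x (Suc k) - x k) \<longlonglongrightarrow> xt - xt"
    by (intro tendsto_diff lim LIMSEQ_Suc)
  then have D: "(\<lambda>k. norm (x (Suc k) - x k)) \<longlonglongrightarrow> 0"
    using tendsto_norm_zero by fastforce
  have "(\<lambda>k. s k - x k) \<longlonglongrightarrow> 0"
    by (rule Lim_null_comparison[OF _ D]) (use s(2) in auto)
  from tendsto_add[OF this lim] have s_lim: "s \<longlonglongrightarrow> xt"
    by simp
  have "continuous_on \<Omega> neg_grad"
    unfolding neg_grad_def by (intro continuous_on_minus lipschitz_on_continuous_on[OF lipschitz])
  then have g_lim: "(\<lambda>k. neg_grad (s k)) \<longlonglongrightarrow> neg_grad xt"
    by (rule continuous_on_tendsto_compose[OF _ s_lim \<open>xt \<in> \<Omega>\<close>]) (use s(1) in auto)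
  have "neg_grad xt \<bullet> (w - xt) \<le> 0" if w: "w \<in> \<Omega>" for w
  proof -
    have "neg_grad (s k) \<bullet> (w - s k)
        \<le> (1 + \<tau>) * L / \<tau> * norm (x (Suc k) - x k) * norm (w - s k)" for k
    proof -
      have "neg_grad (s k) \<bullet> (w - s k) \<le> proj_norm \<Omega> (s k) (neg_grad (s k)) * norm (w - s k)"
        by (intro inner_le_proj_norm_mult_norm convex_\<Omega> s(1) diff_in_tangent_cone w)
      also have "\<dots> \<le> (1 + \<tau>) * L / \<tau> * norm (x (Suc k) - x k) * norm (w - s k)"
        using s(3)[of k] \<tau>_pos by (intro mult_right_mono) (auto simp: field_simps)
      finally show ?thesis .
    qed
    moreover have "(\<lambda>k. neg_grad (s k) \<bullet> (w - s k)) \<longlonglongrightarrow> neg_grad xt \<bullet> (w - xt)"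
      by (intro tendsto_intros g_lim s_lim)
    moreover have "(\<lambda>k. (1 + \<tau>) * L / \<tau> * norm (x (Suc k) - x k) * norm (w - s k))
        \<longlonglongrightarrow> (1 + \<tau>) * L / \<tau> * 0 * norm (w - xt)"
      by (intro tendsto_intros D s_lim)
    ultimately show ?thesis
      using LIMSEQ_le by fastforce
  qed
  then have "proj_norm \<Omega> xt (neg_grad xt) = 0"
    by (rule proj_norm_eq_0I[OF convex_\<Omega> \<open>xt \<in> \<Omega>\<close>])
  then show ?thesis
    by (simp add: stationary_def neg_grad_def)
qed

text \<open>The error bound, the contraction and the confinement to the ball of radius \<open>\<delta>\<close> depend on each
  other, so they are proved in one induction. The remaining path from \<open>x k\<close> has length at most
  \<open>M * sqrt (f (x k) - c)\<close>; the additional \<open>sqrt (2 / L)\<close> in the hypothesis on the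
  starting point leaves room for the intermediate points \<open>s k\<close>. The second
  condition on the starting point serves to obtain \<open>c \<le> f (x 0)\<close>; before that is known, \<open>sqrt\<close> in the
  first one could be negative.\<close>

lemma good_steps_linear_convergence:
  fixes x :: "nat \<Rightarrow> 'a"
  assumes mem: "\<And>k. x k \<in> \<Omega>" and steps: "\<And>k. good_step (x k) (x (Suc k)) (s k)"
    and lower: "\<And>k. norm (x k - xs) < \<delta> \<Longrightarrow> c \<le> f (x (Suc k))"
    and error_bound: "\<And>y. y \<in> \<Omega> \<Longrightarrow> norm (y - xs) < \<delta> \<Longrightarrow> c < f y \<Longrightarrow> f y < c + \<eta> \<Longrightarrow>
           sqrt (2 * \<mu>) * sqrt (f y - c) \<le> proj_norm \<Omega> y (neg_grad y)"
    and "\<mu> > 0" and q: "q = inverse (1 + \<mu> / L * (\<tau>\<^sup>2 / (1 + \<tau>)\<^sup>2))"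
    and M: "M = sqrt (2 / L) * (sqrt (1 - q) / (1 - sqrt q))"
    and start: "norm (x 0 - xs) + (M + sqrt (2 / L)) * sqrt (f (x 0) - c) < \<delta>"
      "norm (x 0 - xs) < \<delta>" "f (x 0) < c + \<eta>"
  shows "\<And>k. f (x k) - c \<le> q ^ k * (f (x 0) - c)"
    and "\<exists>xt\<in>\<Omega>. stationary \<Omega> f xt \<and> f xt = c \<and> x \<longlonglongrightarrow> xt \<and>
      (\<forall>k. norm (x k - xt) \<le> M * sqrt (f (x 0) - c) * sqrt q ^ k)"
proof -
  define \<phi> where "\<phi> k = f (x k) - c" for k
  have q01: "0 < q" "q < 1"
    using \<open>\<mu> > 0\<close> L_pos \<tau>_pos by (auto simp: q add_pos_pos inverse_less_1_iff)
  have sq1: "0 < sqrt q" "sqrt q < 1"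
    using q01 by auto
  have M0: "M \<ge> 0"
    using q01 sq1 L_pos by (simp add: M)
  have mono: "f (x (Suc k)) \<le> f (x k)" for k
    using steps[of k] by (simp add: good_step_def)
  have mono0: "f (x k) \<le> f (x 0)" for k
    by (induction k) (use mono order_trans in \<open>blast+\<close>)
  have \<phi>0: "\<phi> 0 \<ge> 0"
    using lower[OF start(2)] mono[of 0] by (simp add: \<phi>_def)
  have step: "\<phi> (Suc k) \<ge> 0 \<and> \<phi> (Suc k) \<le> q * \<phi> k \<and>
      norm (x (Suc k) - x k) \<le> M * (sqrt (\<phi> k) - sqrt (\<phi> (Suc k)))"
    if pos: "\<phi> k \<ge> 0" and near: "norm (x k - x 0) \<le> M * (sqrt (\<phi> 0) - sqrt (\<phi> k))" for k
  proof -
    note st = steps[of k]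
    have "M * (sqrt (\<phi> 0) - sqrt (\<phi> k)) \<le> M * sqrt (\<phi> 0)"
      using M0 pos by (intro mult_left_mono) auto
    with near have "norm (x k - x 0) \<le> M * sqrt (\<phi> 0)"
      by linarith
    then have xk: "norm (x k - xs) \<le> norm (x 0 - xs) + M * sqrt (\<phi> 0)"
      using norm_triangle_ineq[of "x k - x 0" "x 0 - xs"] by simp
    have room: "norm (x 0 - xs) + M * sqrt (\<phi> 0) + sqrt (2 / L) * sqrt (\<phi> 0) < \<delta>"
      using start(1) by (simp add: \<phi>_def algebra_simps)
    have "0 \<le> sqrt (2 / L) * sqrt (\<phi> 0)"
      using \<phi>0 L_pos by simp
    with xk room have "norm (x k - xs) < \<delta>"
      by linarith
    then have low: "c \<le> f (x (Suc k))"
      by (rule lower)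
    have len: "norm (x (Suc k) - x k) \<le> sqrt (2 / L) * sqrt (\<phi> k - \<phi> (Suc k))"
      using good_step_length[OF st] by (simp add: \<phi>_def)
    also have "\<dots> \<le> sqrt (2 / L) * sqrt (\<phi> 0)"
      using low L_pos mono0[of k] by (intro mult_left_mono) (auto simp: \<phi>_def)
    finally have "norm (s k - x k) \<le> sqrt (2 / L) * sqrt (\<phi> 0)"
      using st by (simp add: good_step_def)
    with xk room have sk: "norm (s k - xs) < \<delta>"
      using norm_triangle_ineq[of "s k - x k" "x k - xs"] by simp
    have "f (s k) < c + \<eta>"
      using st mono0[of k] start(3) by (simp add: good_step_def)
    then have "c < f (s k) \<Longrightarrow> sqrt (2 * \<mu>) * sqrt (f (s k) - c) \<le> proj_norm \<Omega> (s k) (neg_grad (s k))"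
      using error_bound[of "s k"] sk st by (simp add: good_step_def)
    then have contr: "\<phi> (Suc k) \<le> q * \<phi> k"
      using good_step_contraction[OF st low \<open>\<mu> > 0\<close> _ q] by (simp add: \<phi>_def)
    have pos': "\<phi> (Suc k) \<ge> 0"
      using low by (simp add: \<phi>_def)
    note len
    also have "sqrt (2 / L) * sqrt (\<phi> k - \<phi> (Suc k))
        \<le> sqrt (2 / L) * (sqrt (1 - q) / (1 - sqrt q) * (sqrt (\<phi> k) - sqrt (\<phi> (Suc k))))"
      using sqrt_diff_le_diff_sqrt[OF pos' contr q01 pos] L_pos by (intro mult_left_mono) auto
    finally show ?thesis
      using contr pos' by (simp add: M)
  qed
  have inv: "\<phi> k \<ge> 0 \<and> norm (x k - x 0) \<le> M * (sqrt (\<phi> 0) - sqrt (\<phi> k))" for k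
  proof (induction k)
    case 0
    then show ?case using \<phi>0 by simp
  next
    case (Suc k)
    then have "norm (x (Suc k) - x k) \<le> M * (sqrt (\<phi> k) - sqrt (\<phi> (Suc k)))" "\<phi> (Suc k) \<ge> 0"
      using step by blast+
    then show ?case
      using Suc norm_triangle_ineq[of "x (Suc k) - x k" "x k - x 0"] by (simp add: algebra_simps)
  qed
  have pos: "\<phi> k \<ge> 0" and contr: "\<phi> (Suc k) \<le> q * \<phi> k"
    and len: "norm (x (Suc k) - x k) \<le> M * (sqrt (\<phi> k) - sqrt (\<phi> (Suc k)))" for k
    using inv step by blast+
  have rate: "\<phi> k \<le> q ^ k * \<phi> 0" for k
  proof (induction k)
    case (Suc k)
    have "\<phi> (Suc k) \<le> q * \<phi> k"
      by (rule contr)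
    also have "\<dots> \<le> q * (q ^ k * \<phi> 0)"
      using Suc q01 by simp
    finally show ?case
      by (simp add: mult.assoc)
  qed simp
  then show "f (x k) - c \<le> q ^ k * (f (x 0) - c)" for k
    by (simp add: \<phi>_def)
  have tail: "norm (x (k + j) - x k) \<le> M * sqrt (\<phi> 0) * sqrt q ^ k" for k j
  proof -
    have "norm (x (k + j) - x k) \<le> M * (sqrt (\<phi> k) - sqrt (\<phi> (k + j)))"
    proof (induction j)
      case (Suc j)
      then show ?case
        using len[of "k + j"] norm_triangle_ineq[of "x (Suc (k + j)) - x (k + j)" "x (k + j) - x k"]
        by (simp add: algebra_simps)
    qed simp
    also have "\<dots> \<le> M * sqrt (q ^ k * \<phi> 0)"
    proof (rule mult_left_mono[OF _ M0])
      have "sqrt (\<phi> k) \<le> sqrt (q ^ k * \<phi> 0)" "0 \<le> sqrt (\<phi> (k + j))"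
        using rate[of k] pos[of "k + j"] by auto
      then show "sqrt (\<phi> k) - sqrt (\<phi> (k + j)) \<le> sqrt (q ^ k * \<phi> 0)"
        by linarith
    qed
    also have "\<dots> = M * sqrt (\<phi> 0) * sqrt q ^ k"
      by (simp add: real_sqrt_mult real_sqrt_power)
    finally show ?thesis .
  qed
  have bound_lim: "(\<lambda>k. M * sqrt (\<phi> 0) * sqrt q ^ k) \<longlonglongrightarrow> 0"
    using sq1 by (intro tendsto_mult_right_zero LIMSEQ_power_zero) auto
  have "Cauchy x"
  proof (rule metric_CauchyI)
    fix e :: real assume "e > 0"
    then obtain N where "M * sqrt (\<phi> 0) * sqrt q ^ N < e / 2"
      using order_tendstoD(2)[OF bound_lim, of "e / 2"] eventually_sequentially by auto
    moreover have "dist (x n) (x N) \<le> M * sqrt (\<phi> 0) * sqrt q ^ N" if "n \<ge> N" for n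
      using tail[of N "n - N"] that by (simp add: dist_norm)
    ultimately have "dist (x n) (x N) < e / 2" if "n \<ge> N" for n
      using that by (meson le_less_trans)
    then show "\<exists>N. \<forall>m\<ge>N. \<forall>n\<ge>N. dist (x m) (x n) < e"
      by (metis dist_triangle_half_l dist_commute)
  qed
  then obtain xt where lim: "x \<longlonglongrightarrow> xt"
    using Cauchy_convergent convergent_def by blast
  have xt: "xt \<in> \<Omega>"
    using closed_sequentially[OF compact_imp_closed[OF compact_\<Omega>]] mem lim by blast
  have "(\<lambda>k. f (x k)) \<longlonglongrightarrow> f xt"
    using isCont_tendsto_compose[OF GDERIV_imp_isCont[OF C1_near_GDERIV[OF C1 xt]] lim] .
  then have "\<phi> \<longlonglongrightarrow> f xt - c"
    unfolding \<phi>_def by (intro tendsto_diff tendsto_const)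
  moreover have "\<phi> \<longlonglongrightarrow> 0"
  proof (rule tendsto_sandwich[where f = "\<lambda>_. 0" and h = "\<lambda>k. q ^ k * \<phi> 0"])
    show "(\<lambda>k. q ^ k * \<phi> 0) \<longlonglongrightarrow> 0"
      using q01 by (intro tendsto_mult_left_zero LIMSEQ_power_zero) auto
  qed (use pos rate in auto)
  ultimately have "f xt = c"
    using LIMSEQ_unique by fastforce
  moreover have "norm (x k - xt) \<le> M * sqrt (\<phi> 0) * sqrt q ^ k" for k
  proof -
    have "(\<lambda>j. norm (x (j + k) - x k)) \<longlonglongrightarrow> norm (xt - x k)"
      by (intro tendsto_intros LIMSEQ_ignore_initial_segment lim)
    then have "norm (xt - x k) \<le> M * sqrt (\<phi> 0) * sqrt q ^ k"
      by (rule LIMSEQ_le_const2) (use tail[of k] in \<open>simp add: add.commute\<close>)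
    then show ?thesis
      by (simp add: norm_minus_commute)
  qed
  ultimately show "\<exists>xt\<in>\<Omega>. stationary \<Omega> f xt \<and> f xt = c \<and> x \<longlonglongrightarrow> xt \<and>
      (\<forall>k. norm (x k - xt) \<le> M * sqrt (f (x 0) - c) * sqrt q ^ k)"
    using limit_stationary[OF steps lim xt] lim xt by (auto simp: \<phi>_def)
qed

end

theorem theorem4p2:
  fixes \<Omega> :: "(real ^ 'n) set"
    and f :: "real ^ 'n \<Rightarrow> real"
    and A :: "real ^ 'n \<Rightarrow> real ^ 'n \<Rightarrow> (real ^ 'n) set"
    and xs :: "real ^ 'n"
    and L \<tau> \<mu> \<eta> \<delta> q :: real
  assumes "compact \<Omega>" and "convex \<Omega>"
    and "C1_near \<Omega> f" and "L > 0" and "L-lipschitz_on \<Omega> (grad f)"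
    and "is_method \<Omega> A" and "SB A \<Omega> = \<tau>" and "\<tau> > 0"
    and "\<And>xbar. xbar \<in> \<Omega> \<Longrightarrow> ssc_terminates A \<Omega> L xbar (- grad f xbar)"
    and "\<mu> > 0"
    and "xs \<in> \<Omega>" and "stationary \<Omega> f xs"
    and "\<eta> > 0" and "\<delta> > 0"
    and "\<And>x. x \<in> \<Omega> \<Longrightarrow> norm (x - xs) < \<delta> \<Longrightarrow> f xs < f x \<Longrightarrow> f x < f xs + \<eta> \<Longrightarrow>
           proj_norm \<Omega> x (- grad f x) \<ge> sqrt (2 * \<mu>) * sqrt (f x - f xs)"
    and "q = inverse (1 + \<mu> / L * (\<tau>\<^sup>2 / (1 + \<tau>)\<^sup>2))"
  shows "\<exists>\<delta>'>0. \<forall>x :: nat \<Rightarrow> real ^ 'n.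
           ssc_sequence A \<Omega> L f x \<longrightarrow>
           (\<forall>k. norm (x k - xs) < \<delta> \<longrightarrow> f (x (Suc k)) \<ge> f xs) \<longrightarrow>
           norm (x 0 - xs) < \<delta>' \<longrightarrow>
             (\<forall>k. f (x k) - f xs \<le> q ^ k * (f (x 0) - f xs)) \<and>
             (\<exists>xt\<in>\<Omega>. stationary \<Omega> f xt \<and> f xt = f xs \<and> x \<longlonglongrightarrow> xt \<and>
                (\<forall>k. norm (x k - xt) \<le>
                   sqrt (2 - 2 * q) * sqrt (f (x 0) - f xt) / (sqrt L * (1 - sqrt q))
                     * q powr (real k / 2)))"
proof -
  interpret ssc_setting \<Omega> f A L \<tau>
    using assms(1-8) by unfold_locales
  define M where "M = sqrt (2 / L) * (sqrt (1 - q) / (1 - sqrt q))"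
  have "0 < \<mu> / L * (\<tau>\<^sup>2 / (1 + \<tau>)\<^sup>2)"
    using assms by simp
  then have q0: "q > 0"
    using assms by (simp add: add_pos_pos)
  \<comment> \<open>The left-hand sides of the three conditions on the starting point are continuous in \<open>y\<close> and
    hold at \<open>xs\<close> itself.\<close>
  have cont: "isCont f xs"
    using assms GDERIV_imp_isCont C1_near_GDERIV by blast
  have "\<forall>\<^sub>F y in nhds xs. norm (y - xs) + (M + sqrt (2 / L)) * sqrt (f y - f xs) < \<delta>
      \<and> norm (y - xs) < \<delta> \<and> f y < f xs + \<eta>"
  proof (intro eventually_conj order_tendstoD(2))
    have f: "(f \<longlongrightarrow> f xs) (nhds xs)"
      using cont by (simp add: isCont_def tendsto_at_iff_tendsto_nhds)
    show "((\<lambda>y. norm (y - xs) + (M + sqrt (2 / L)) * sqrt (f y - f xs))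
        \<longlongrightarrow> norm (xs - xs) + (M + sqrt (2 / L)) * sqrt (f xs - f xs)) (nhds xs)"
      by (intro tendsto_intros f filterlim_ident)
    show "((\<lambda>y. norm (y - xs)) \<longlongrightarrow> norm (xs - xs)) (nhds xs)"
      by (intro tendsto_intros filterlim_ident)
    show "(f \<longlongrightarrow> f xs) (nhds xs)"
      by (rule f)
  qed (use assms in auto)
  then obtain \<delta>' where "\<delta>' > 0" and start: "\<And>y. norm (y - xs) < \<delta>' \<Longrightarrow>
      norm (y - xs) + (M + sqrt (2 / L)) * sqrt (f y - f xs) < \<delta>
      \<and> norm (y - xs) < \<delta> \<and> f y < f xs + \<eta>"
    unfolding eventually_nhds_metric dist_norm by blast
  show ?thesis
  proof (intro exI[of _ \<delta>'] conjI allI impI \<open>\<delta>' > 0\<close>)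
    fix x :: "nat \<Rightarrow> real ^ 'n"
    assume seq: "ssc_sequence A \<Omega> L f x"
      and lower: "\<forall>k. norm (x k - xs) < \<delta> \<longrightarrow> f (x (Suc k)) \<ge> f xs"
      and x0: "norm (x 0 - xs) < \<delta>'"
    obtain s where s: "\<And>k. good_step (x k) (x (Suc k)) (s k)"
      using ssc_sequence_good_steps(2)[OF seq] by metis
    have lower': "f xs \<le> f (x (Suc k))" if "norm (x k - xs) < \<delta>" for k
      using lower that by blast
    note conv = good_steps_linear_convergence[where x = x and c = "f xs",
        OF ssc_sequence_good_steps(1)[OF seq] s lower' assms(15)[folded neg_grad_def] assms(10,16) M_def]
    show "f (x k) - f xs \<le> q ^ k * (f (x 0) - f xs)" for k
      by (rule conv(1)) (use start[OF x0] in auto)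
    have "\<exists>xt\<in>\<Omega>. stationary \<Omega> f xt \<and> f xt = f xs \<and> x \<longlonglongrightarrow> xt \<and>
      (\<forall>k. norm (x k - xt) \<le> M * sqrt (f (x 0) - f xs) * sqrt q ^ k)"
      by (rule conv(2)) (use start[OF x0] in auto)
    moreover have "M * sqrt (f (x 0) - f xs) * sqrt q ^ k
        = sqrt (2 - 2 * q) * sqrt (f (x 0) - f xs) / (sqrt L * (1 - sqrt q)) * q powr (real k / 2)"
      for k
    proof -
      have "sqrt q ^ k = q powr (real k / 2)"
        using q0 by (simp add: powr_half_sqrt[symmetric] powr_powr flip: powr_realpow)
      moreover have "sqrt (2 - 2 * q) = sqrt 2 * sqrt (1 - q)"
        by (simp add: algebra_simps flip: real_sqrt_mult)
      ultimately show ?thesis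
        by (simp add: M_def real_sqrt_divide)
    qed
    ultimately show "\<exists>xt\<in>\<Omega>. stationary \<Omega> f xt \<and> f xt = f xs \<and> x \<longlonglongrightarrow> xt \<and>
        (\<forall>k. norm (x k - xt) \<le>
           sqrt (2 - 2 * q) * sqrt (f (x 0) - f xt) / (sqrt L * (1 - sqrt q))
             * q powr (real k / 2))"
      by metis
  qed
qed

end
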